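(* Let $a<s$, $c>0$, $\beta>1$ be real numbers, and let $w:[a,\infty)\to(0,1]$ be continuous with $$w(x)\;\le\;e^{-c\,(x-s)^{\beta}}\qquad\text{for }x\ge s.$$ There exist a constant $K=K(a,s)>0$, depending only on $a$ and $s$, and $n_0=n_0(a,s,c,\beta)\in\mathbb{N}$, depending only on $a,s,c,\beta$, such that for all integers $n\ge n_0$, setting $$b_n \;=\; s+\Bigl(\frac{K\,n\log n}{c}\Bigr)^{1/\beta},$$ every polynomial $P$ of degree at most $n$ satisfies $$\|wP\|_{[b_n,\infty)}\;\le\;e^{-n}\,\|P\|_{[a,s]}.$$ Consequently, for every $f\in C[a,\infty)$ (and all such $n$ and $P$), $$\|f-wP\|_{[a,b_n]}\;\le\;\|f-wP\|_{[a,\infty)}\;\le\;\|f-wP\|_{[a,b_n]}+\|f\|_{[b_n,\infty)}+e^{-n}\,\|P\|_{[a,s]}.$$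
   Context: For a set $I\subset\mathbb{R}$, $\|g\|_I:=\sup_{x\in I}|g(x)|\in[0,\infty]$ is the supremum norm on $I$. $C[a,\infty)$ is the set of real-valued continuous functions on $[a,\infty)$. Polynomials are univariate algebraic polynomials with real coefficients. *)

theory Defs
  imports
    Complex_Main
    "HOL-Library.Extended_Nonnegative_Real"
    "HOL-Computational_Algebra.Polynomial"
begin

text \<open>Supremum norms take values in \<open>[0,\<infinity>]\<close>, since for instance a continuous function on
  an unbounded interval need not be bounded.\<close>

definition sup_norm_on :: "real set \<Rightarrow> (real \<Rightarrow> real) \<Rightarrow> ennreal"
  where "sup_norm_on I g = (SUP x\<in>I. ennreal \<bar>g x\<bar>)"

text \<open>Functions on \<open>[a,\<infinity>)\<close> are total functions of which only the values on
  \<open>{a..}\<close> matter.\<close>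

definition admissible_weight :: "real \<Rightarrow> real \<Rightarrow> real \<Rightarrow> real \<Rightarrow> (real \<Rightarrow> real) \<Rightarrow> bool"
  where "admissible_weight a s c \<beta> w \<longleftrightarrow>
    continuous_on {a..} w \<and>
    (\<forall>x\<ge>a. 0 < w x \<and> w x \<le> 1) \<and>
    (\<forall>x\<ge>s. w x \<le> exp (- c * (x - s) powr \<beta>))"

definition cutoff :: "real \<Rightarrow> real \<Rightarrow> real \<Rightarrow> real \<Rightarrow> nat \<Rightarrow> real"
  where "cutoff s K c \<beta> n = s + (K * real n * ln (real n) / c) powr (1 / \<beta>)"

end

theory Submission
  imports Defs
begin

text \<open>With \<open>t = x - s\<close>, polynomial growth off \<open>[a,s]\<close> gives
  \<open>\<bar>P x\<bar> \<le> \<parallel>P\<parallel> (n (3 + 2 t / (s - a)))\<^sup>n\<close>, obtained by dividing out a linear factor \<open>n\<close> times while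
  the interval shrinks by \<open>(s - a) / n\<close> each time. Writing \<open>u = c t\<^sup>\<beta>\<close>, the logarithm of this
  factor is at most \<open>2 n ln n + u / 2 + O(n)\<close>, which the weight \<open>exp (- u)\<close> beats by
  a factor \<open>exp (- n)\<close> as soon as \<open>u \<ge> 6 n ln n\<close> and \<open>n\<close> is large; so \<open>K = 6\<close> works.\<close>

text \<open>Induction on \<open>k\<close>, splitting off the linear factor at the right endpoint
  \<open>r\<close>. On the interval shortened by \<open>h\<close> that factor has modulus at least
  \<open>h\<close>, so the quotient is at most \<open>2 * M / h\<close> there. A Chebyshev-type
  bound would be sharper, but with \<open>h\<close> of order \<open>1 / n\<close> the loss is about
  \<open>n ^ n\<close>, of the size that a cutoff with \<open>n ln n\<close> can absorb.\<close>

lemma poly_growth_bound: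
  fixes P :: "real poly" and a h M x :: real
  assumes "h > 0" "degree P \<le> k" "a + real k * h \<le> x"
    and "\<And>y. a \<le> y \<Longrightarrow> y \<le> a + real k * h \<Longrightarrow> \<bar>poly P y\<bar> \<le> M"
  shows "\<bar>poly P x\<bar> \<le> M * (1 + 2 * (x - a) / h) ^ k"
  using assms
proof (induction k arbitrary: P M)
  case 0
  then obtain p where "P = [:p:]" using degree_eq_zeroE by blast
  with "0.prems"(4)[of a] show ?case by simp
next
  case (Suc k)
  define r where "r = a + real (Suc k) * h"
  define Q where "Q = synthetic_div P r"
  define D where "D = 1 + 2 * (x - a) / h"
  have P: "poly P y = (y - r) * poly Q y + poly P r" for y
    using arg_cong[OF synthetic_div_correct'[of r P], of "\<lambda>p. poly p y"]
    by (simp add: Q_def algebra_simps)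
  have r: "r = a + real k * h + h" "a \<le> r" "r \<le> x"
    using Suc.prems by (auto simp: r_def algebra_simps)
  have Pr: "\<bar>poly P r\<bar> \<le> M"
    using Suc.prems(4)[of r] r by (simp add: r_def)
  have M: "0 \<le> M" using Pr by linarith
  have D: "1 \<le> D" using r(2,3) Suc.prems(1) unfolding D_def by auto
  have Q: "\<bar>poly Q x\<bar> \<le> 2 * M / h * D ^ k"
    unfolding D_def
  proof (rule Suc.IH)
    show "degree Q \<le> k" using Suc.prems(2) by (simp add: Q_def degree_synthetic_div)
    show "a + real k * h \<le> x" using r Suc.prems(1) by linarith
    fix y assume y: "a \<le> y" "y \<le> a + real k * h"
    have "\<bar>poly P y\<bar> \<le> M"
      using Suc.prems(4)[of y] y r Suc.prems(1) by (simp add: r_def)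
    then have "\<bar>y - r\<bar> * \<bar>poly Q y\<bar> \<le> 2 * M"
      using P[of y] Pr by (simp flip: abs_mult)
    moreover have "h * \<bar>poly Q y\<bar> \<le> \<bar>y - r\<bar> * \<bar>poly Q y\<bar>"
      using y r by (intro mult_right_mono) auto
    ultimately show "\<bar>poly Q y\<bar> \<le> 2 * M / h"
      using Suc.prems(1) by (simp add: field_simps)
  qed (use Suc.prems in auto)
  have "\<bar>poly P x\<bar> \<le> \<bar>x - r\<bar> * \<bar>poly Q x\<bar> + \<bar>poly P r\<bar>"
    using P[of x] abs_triangle_ineq by (metis abs_mult)
  \<comment> \<open>Enlarging \<open>x - r\<close> to \<open>x - a\<close> and \<open>M\<close> to
    \<open>M * D ^ k\<close> makes the sum factor as \<open>M * D ^ k * D\<close>.\<close>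
  also have "\<dots> \<le> (x - a) * (2 * M / h * D ^ k) + M * D ^ k"
  proof (intro add_mono mult_mono Q)
    show "\<bar>poly P r\<bar> \<le> M * D ^ k"
      using Pr M mult_left_mono[OF one_le_power[OF D, of k] M] by linarith
  qed (use r in auto)
  also have "\<dots> = M * D ^ Suc k"
    by (simp add: D_def algebra_simps)
  finally show ?case by (simp add: D_def)
qed

text \<open>After taking logarithms, the powers of \<open>n\<close>, the constants depending on
  \<open>L\<close> and \<open>c\<close>, and the growth in \<open>t\<close> each cost at most about
  \<open>n ln n\<close>, apart from a term \<open>u / 2\<close> that the weight exponent
  \<open>u\<close> can spare.\<close>

lemma growth_times_weight_le:
  fixes L c \<beta> t :: real and n :: nat
  assumes "L > 0" "c > 0" "\<beta> > 1" "n \<ge> 3" "t \<ge> 0"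
    and n: "exp 1 * (3 + 2 / L + 2 / (c * L)) \<le> real n"
    and t: "(6 * real n * ln (real n) / c) powr (1 / \<beta>) \<le> t"
  shows "exp (- c * t powr \<beta>) * (real n * (3 + 2 * t / L)) ^ n \<le> exp (- real n)"
proof -
  define u where "u = c * t powr \<beta>"
  define A where "A = 3 + 2 / L + 2 / (c * L)"
  have "exp 1 \<le> real n" using exp_le assms(4) by linarith
  then have ln_n: "1 \<le> ln (real n)" using assms(4) by (subst ln_ge_iff) auto
  have A: "A > 0" using assms by (simp add: A_def add_pos_pos)
  \<comment> \<open>The size condition on \<open>n\<close> serves here: \<open>ln A\<close> is
    absorbed by \<open>ln n\<close> with one unit to spare, and this unit, multiplied by
    \<open>n\<close>, becomes the final factor \<open>exp (- n)\<close>.\<close>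
  have "ln (exp 1 * A) \<le> ln (real n)"
    using n A assms(4) unfolding A_def by (subst ln_le_cancel_iff) auto
  then have lnA: "1 + ln A \<le> ln (real n)" using A by (simp add: ln_mult)
  have "6 * real n * ln (real n) / c = ((6 * real n * ln (real n) / c) powr (1 / \<beta>)) powr \<beta>"
    using assms ln_n by (simp add: powr_powr)
  also have "\<dots> \<le> t powr \<beta>" using t assms by (intro powr_mono2) auto
  finally have u: "6 * real n * ln (real n) \<le> u"
    using assms by (simp add: u_def field_simps)
  have "real n * 1 \<le> real n * ln (real n)" using ln_n by (intro mult_left_mono) auto
  then have u1: "1 \<le> u" using u assms(4) by linarith
  \<comment> \<open>From \<open>\<beta> > 1\<close>, this makes the growth factor linear in
    \<open>u\<close> with a coefficient free of \<open>\<beta>\<close>.\<close>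
  have "t \<le> 1 + t powr \<beta>"
  proof (cases "t \<le> 1")
    case False
    then have "t powr 1 \<le> t powr \<beta>" using assms by (intro powr_mono) auto
    then show ?thesis using False by simp
  qed (use powr_ge_zero[of t \<beta>] in linarith)
  then have "t \<le> 1 + u / c" using assms by (simp add: u_def)
  then have "2 * t / L \<le> 2 * (1 + u / c) / L"
    using assms by (intro divide_right_mono) auto
  also have "\<dots> = 2 / L + 2 / (c * L) * u"
    using assms by (simp add: field_simps)
  finally have "3 + 2 * t / L \<le> 3 + 2 / L + 2 / (c * L) * u" by linarith
  also have "\<dots> \<le> (3 + 2 / L) * u + 2 / (c * L) * u"
    using mult_left_mono[OF u1, of "3 + 2 / L"] assms by simp
  also have "\<dots> = A * u" by (simp add: A_def algebra_simps)
  finally have G: "3 + 2 * t / L \<le> A * u" .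
  \<comment> \<open>The scale \<open>2 * n\<close> is chosen so that, after multiplication by
    \<open>n\<close>, the linear part of the bound on \<open>ln u\<close> is exactly
    \<open>u / 2\<close>.\<close>
  have "ln (u / (2 * real n)) \<le> u / (2 * real n) - 1"
    using u1 assms(4) by (intro ln_le_minus_one) auto
  then have "ln u \<le> ln (real n) + u / (2 * real n)"
    using u1 assms(4) ln_2_less_1 by (simp add: ln_div ln_mult)
  then have "ln (real n) + ln A + ln u \<le> 3 * ln (real n) - 1 + u / (2 * real n)"
    using lnA by linarith
  then have "real n * (ln (real n) + ln A + ln u)
      \<le> real n * (3 * ln (real n) - 1 + u / (2 * real n))"
    by (intro mult_left_mono) auto
  also have "\<dots> = 3 * real n * ln (real n) - real n + u / 2"
    using assms(4) by (simp add: field_simps)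
  \<comment> \<open>Origin of the constant 6: three terms \<open>n ln n\<close> have to fit into the
    remaining \<open>u / 2\<close>.\<close>
  also have "\<dots> \<le> u - real n" using u by linarith
  finally have E: "real n * (ln (real n) + ln A + ln u) \<le> u - real n" .
  have "(real n * (3 + 2 * t / L)) ^ n \<le> (real n * (A * u)) ^ n"
    using G assms by (intro power_mono mult_left_mono) auto
  also have "real n * (A * u) = exp (ln (real n) + ln A + ln u)"
    using A u1 assms(4) by (simp add: exp_add)
  also have "\<dots> ^ n = exp (real n * (ln (real n) + ln A + ln u))"
    by (simp add: exp_of_nat_mult)
  also have "\<dots> \<le> exp (u - real n)" using E by simp
  finally have "exp (- u) * (real n * (3 + 2 * t / L)) ^ n \<le> exp (- u) * exp (u - real n)"
    by (intro mult_left_mono) auto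
  then show ?thesis by (simp add: u_def flip: exp_add)
qed

lemma sup_norm_on_upper: "x \<in> I \<Longrightarrow> ennreal \<bar>g x\<bar> \<le> sup_norm_on I g"
  unfolding sup_norm_on_def by (rule SUP_upper)

lemma sup_norm_on_mono: "I \<subseteq> J \<Longrightarrow> sup_norm_on I g \<le> sup_norm_on J g"
  unfolding sup_norm_on_def by (rule SUP_subset_mono) auto

lemma sup_norm_on_atLeast_diff_le:
  "sup_norm_on {a..} (\<lambda>x. f x - g x)
    \<le> sup_norm_on {a..b} (\<lambda>x. f x - g x) + sup_norm_on {b..} f + sup_norm_on {b..} g"
proof -
  have "ennreal \<bar>f x - g x\<bar>
      \<le> sup_norm_on {a..b} (\<lambda>x. f x - g x) + sup_norm_on {b..} f + sup_norm_on {b..} g"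
    if "a \<le> x" for x
  proof (cases "x \<le> b")
    case True
    then have "ennreal \<bar>f x - g x\<bar> \<le> sup_norm_on {a..b} (\<lambda>x. f x - g x)"
      using that sup_norm_on_upper[of x "{a..b}" "\<lambda>x. f x - g x"] by simp
    then show ?thesis by (simp add: add.assoc add_increasing2)
  next
    case False
    have "ennreal \<bar>f x - g x\<bar> \<le> ennreal (\<bar>f x\<bar> + \<bar>g x\<bar>)"
      by (intro ennreal_leI abs_triangle_ineq4)
    also have "\<dots> = ennreal \<bar>f x\<bar> + ennreal \<bar>g x\<bar>" by simp
    also have "\<dots> \<le> sup_norm_on {b..} f + sup_norm_on {b..} g"
      using False by (intro add_mono sup_norm_on_upper) auto
    finally show ?thesis by (simp add: add.assoc add_increasing)
  qed
  then show ?thesis unfolding sup_norm_on_def[of "{a..}"] by (auto intro: SUP_least)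
qed

lemma weighted_poly_tail_bound:
  fixes P :: "real poly"
  assumes "a < s" "c > 0" "\<beta> > 1" "admissible_weight a s c \<beta> w"
    and "n \<ge> 3" "exp 1 * (3 + 2 / (s - a) + 2 / (c * (s - a))) \<le> real n" "degree P \<le> n"
  shows "sup_norm_on {cutoff s 6 c \<beta> n..} (\<lambda>x. w x * poly P x)
    \<le> ennreal (exp (- real n)) * sup_norm_on {a..s} (poly P)"
proof (cases "sup_norm_on {a..s} (poly P) = top")
  \<comment> \<open>Compactness would exclude this case, but an infinite right-hand side is simply
    trivial, as \<open>exp (- n)\<close> is nonzero.\<close>
  case True
  then show ?thesis by (simp add: ennreal_mult_top)
next
  case False
  then obtain M where M: "M \<ge> 0" "sup_norm_on {a..s} (poly P) = ennreal M"
    by (cases "sup_norm_on {a..s} (poly P)") auto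
  have PM: "\<bar>poly P y\<bar> \<le> M" if "a \<le> y" "y \<le> s" for y
    using sup_norm_on_upper[of y "{a..s}" "poly P"] that M by simp
  have "\<bar>w x * poly P x\<bar> \<le> exp (- real n) * M" if x: "cutoff s 6 c \<beta> n \<le> x" for x
  proof -
    define t where "t = x - s"
    have t: "(6 * real n * ln (real n) / c) powr (1 / \<beta>) \<le> t"
      using x by (simp add: cutoff_def t_def)
    have t0: "0 \<le> t" using powr_ge_zero t by (rule order_trans)
    have w: "0 < w x" "w x \<le> exp (- c * t powr \<beta>)"
      using assms(1,4) t0 by (auto simp: admissible_weight_def t_def)
    \<comment> \<open>With \<open>h = (s - a) / n\<close>, the \<open>n\<close> shrinkings use up
      exactly \<open>[a, s]\<close>.\<close>
    have s: "a + real n * ((s - a) / real n) = s" using assms(5) by simp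
    have "\<bar>poly P x\<bar> \<le> M * (1 + 2 * (x - a) / ((s - a) / real n)) ^ n"
      by (rule poly_growth_bound) (use assms t0 PM s in \<open>auto simp: t_def\<close>)
    also have "2 * (x - a) / ((s - a) / real n) = real n * (2 + 2 * t / (s - a))"
      using assms(1,5) by (simp add: t_def field_simps)
    also have "M * (1 + \<dots>) ^ n \<le> M * (real n * (3 + 2 * t / (s - a))) ^ n"
      using assms(1,5) M t0 by (intro mult_left_mono power_mono) (auto simp: algebra_simps)
    finally have "\<bar>w x * poly P x\<bar>
        \<le> exp (- c * t powr \<beta>) * (M * (real n * (3 + 2 * t / (s - a))) ^ n)"
      unfolding abs_mult using w by (intro mult_mono) auto
    also have "\<dots> = M * (exp (- c * t powr \<beta>) * (real n * (3 + 2 * t / (s - a))) ^ n)"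
      by simp
    also have "\<dots> \<le> M * exp (- real n)"
      using assms t t0 M by (intro mult_left_mono growth_times_weight_le) auto
    finally show ?thesis by (simp add: mult.commute)
  qed
  then show ?thesis
    unfolding M(2) sup_norm_on_def[of "{cutoff s 6 c \<beta> n..}"] using M(1)
    by (auto intro!: SUP_least ennreal_leI simp flip: ennreal_mult)
qed

theorem proposition6p2:
  fixes a s :: real
  assumes "a < s"
  shows "\<exists>K::real. K > 0 \<and>
    (\<forall>c \<beta> :: real. c > 0 \<longrightarrow> \<beta> > 1 \<longrightarrow>
      (\<exists>n\<^sub>0::nat. \<forall>w. admissible_weight a s c \<beta> w \<longrightarrow>
        (\<forall>n\<ge>n\<^sub>0. \<forall>P :: real poly. degree P \<le> n \<longrightarrow>
          sup_norm_on {cutoff s K c \<beta> n..} (\<lambda>x. w x * poly P x)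
            \<le> ennreal (exp (- real n)) * sup_norm_on {a..s} (poly P) \<and>
          (\<forall>f :: real \<Rightarrow> real. continuous_on {a..} f \<longrightarrow>
            sup_norm_on {a..cutoff s K c \<beta> n} (\<lambda>x. f x - w x * poly P x)
              \<le> sup_norm_on {a..} (\<lambda>x. f x - w x * poly P x) \<and>
            sup_norm_on {a..} (\<lambda>x. f x - w x * poly P x)
              \<le> sup_norm_on {a..cutoff s K c \<beta> n} (\<lambda>x. f x - w x * poly P x)
                + sup_norm_on {cutoff s K c \<beta> n..} f
                + ennreal (exp (- real n)) * sup_norm_on {a..s} (poly P)))))"
proof (rule exI[of _ 6], intro conjI allI impI)
  fix c \<beta> :: real
  assume c: "c > 0" and \<beta>: "\<beta> > 1"
  \<comment> \<open>The 3 ensures \<open>exp 1 \<le> n\<close>, hence \<open>ln n \<ge> 1\<close>;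
    the other entry absorbs the constants. Neither involves \<open>w\<close>.\<close>
  define N where "N = max 3 (nat \<lceil>exp 1 * (3 + 2 / (s - a) + 2 / (c * (s - a)))\<rceil>)"
  have tail: "sup_norm_on {cutoff s 6 c \<beta> n..} (\<lambda>x. w x * poly P x)
      \<le> ennreal (exp (- real n)) * sup_norm_on {a..s} (poly P)"
    if "admissible_weight a s c \<beta> w" "N \<le> n" "degree P \<le> n" for w n and P :: "real poly"
  proof (rule weighted_poly_tail_bound[OF assms c \<beta>])
    show "exp 1 * (3 + 2 / (s - a) + 2 / (c * (s - a))) \<le> real n"
      using that(2) unfolding N_def by linarith
  qed (use that in \<open>auto simp: N_def\<close>)
  show "\<exists>n\<^sub>0::nat. \<forall>w. admissible_weight a s c \<beta> w \<longrightarrow>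
        (\<forall>n\<ge>n\<^sub>0. \<forall>P :: real poly. degree P \<le> n \<longrightarrow>
          sup_norm_on {cutoff s 6 c \<beta> n..} (\<lambda>x. w x * poly P x)
            \<le> ennreal (exp (- real n)) * sup_norm_on {a..s} (poly P) \<and>
          (\<forall>f :: real \<Rightarrow> real. continuous_on {a..} f \<longrightarrow>
            sup_norm_on {a..cutoff s 6 c \<beta> n} (\<lambda>x. f x - w x * poly P x)
              \<le> sup_norm_on {a..} (\<lambda>x. f x - w x * poly P x) \<and>
            sup_norm_on {a..} (\<lambda>x. f x - w x * poly P x)
              \<le> sup_norm_on {a..cutoff s 6 c \<beta> n} (\<lambda>x. f x - w x * poly P x)
                + sup_norm_on {cutoff s 6 c \<beta> n..} f
                + ennreal (exp (- real n)) * sup_norm_on {a..s} (poly P)))"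
    \<comment> \<open>\<open>tail\<close> is used twice: as the first claim, and to replace the tail
      norm of \<open>w * P\<close> in the triangle inequality.\<close>
    by (intro exI[of _ N] allI impI conjI tail sup_norm_on_mono
        order_trans[OF sup_norm_on_atLeast_diff_le add_left_mono[OF tail]]) auto
qed simp

end
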